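(* Let $(x_1,x_2,x_3,x_4)\in\mathbb{R}^4$ be initial conditions such that the sequence $(x_n)_{n\ge 1}$ defined by $$x_{n+4}=\max\{x_{n+3},x_{n+2},x_{n+1},0\}-x_n,\qquad n\ge 1,$$ is not periodic. Then the set of accumulation points of $(x_n)_{n\ge 1}$ is a compact interval of $\mathbb{R}$. Moreover, the tuple $(x_1,x_2,x_3,x_4)$ is equivalent (in the sense defined in the context) to some tuple of initial conditions $(x,y,z,w)\in\mathbb{R}^4$ with $x=\max\{x_n : n\ge 1\}$, $x\ge w\ge y\ge z\ge 0$ and $\frac{w-z}{x}\in\mathbb{R}\setminus\mathbb{Q}$, and the set of accumulation points of the orbit is the compact interval $[\min\{w-x,-z\},\,x]$.
   Context: The recurrence $x_{n+4}=\max\{x_{n+3},x_{n+2},x_{n+1},0\}-x_n$ can be run backwards uniquely via $x_n=\max\{x_{n+1},x_{n+2},x_{n+3},0\}-x_{n+4}$, so each tuple $(x_1,x_2,x_3,x_4)\in\mathbb{R}^4$ generates a unique two-sided sequence $(x_n)_{n\in\mathbb{Z}}$ satisfying the recurrence for all $n \in \mathbb{Z}$. Two tuples $\mathbf{x}=(x_1,x_2,x_3,x_4)$ and $\mathbf{y}=(y_1,y_2,y_3,y_4)$ in $\mathbb{R}^4$ are called equivalent if the two-sided sequences $(x_n)_{n\in\mathbb{Z}}$ and $(y_n)_{n\in\mathbb{Z}}$ they generate coincide up to a shift of the index. The orbit of the initial conditions is the sequence $(x_n)_{n\ge1}$; its accumulation points are the limits of its convergent subsequences. *)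

theory Defs
  imports "HOL-Analysis.Analysis"
begin

type_synonym tuple4 = "real \<times> real \<times> real \<times> real"

definition two_sided_solution :: "(int \<Rightarrow> real) \<Rightarrow> bool" where
  "two_sided_solution s \<longleftrightarrow> (\<forall>n. s (n + 4) = Max {s (n + 3), s (n + 2), s (n + 1), 0} - s n)"

definition initial_tuple :: "(int \<Rightarrow> real) \<Rightarrow> tuple4" where
  "initial_tuple s = (s 1, s 2, s 3, s 4)"

text \<open>The description is proper: existence and uniqueness are shown in
  \<open>ex1_two_sided_solution\<close> below.\<close>

definition two_sided_seq :: "tuple4 \<Rightarrow> int \<Rightarrow> real" where
  "two_sided_seq p = (THE s. two_sided_solution s \<and> initial_tuple s = p)"

definition equivalent_tuples :: "tuple4 \<Rightarrow> tuple4 \<Rightarrow> bool" where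
  "equivalent_tuples p q \<longleftrightarrow> (\<exists>k. \<forall>n. two_sided_seq p n = two_sided_seq q (n + k))"

text \<open>Sequences \<open>(x\<^sub>n)\<close> with \<open>n \<ge> 1\<close> are functions on \<^typ>\<open>nat\<close> whose value at \<open>0\<close> is
  irrelevant; the following notions refer to indices \<open>n \<ge> 1\<close> only.\<close>

definition one_sided_solution :: "(nat \<Rightarrow> real) \<Rightarrow> bool" where
  "one_sided_solution x \<longleftrightarrow>
     (\<forall>n\<ge>1. x (n + 4) = Max {x (n + 3), x (n + 2), x (n + 1), 0} - x n)"

definition periodic_seq :: "(nat \<Rightarrow> real) \<Rightarrow> bool" where
  "periodic_seq x \<longleftrightarrow> (\<exists>p\<ge>1. \<forall>n\<ge>1. x (n + p) = x n)"

definition accumulation_points :: "(nat \<Rightarrow> real) \<Rightarrow> real set" where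
  "accumulation_points x =
     {l. \<exists>r. strict_mono r \<and> (\<forall>k. r k \<ge> 1) \<and> (\<lambda>k. x (r k)) \<longlonglongrightarrow> l}"

definition is_maximum_of :: "real \<Rightarrow> (nat \<Rightarrow> real) \<Rightarrow> bool" where
  "is_maximum_of m x \<longleftrightarrow> (\<exists>n\<ge>1. x n = m) \<and> (\<forall>n\<ge>1. x n \<le> m)"

fun fwd :: "tuple4 \<Rightarrow> tuple4" where
  "fwd (a, b, c, d) = (b, c, d, Max {d, c, b, 0} - a)"

fun bwd :: "tuple4 \<Rightarrow> tuple4" where
  "bwd (a, b, c, d) = (Max {a, b, c, 0} - d, a, b, c)"

lemma fwd_bwd: "fwd (bwd p) = p"
  by (cases p) (simp add: insert_commute)

definition state :: "tuple4 \<Rightarrow> int \<Rightarrow> tuple4" where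
  "state p n = (if n \<ge> 1 then (fwd ^^ nat (n - 1)) p else (bwd ^^ nat (1 - n)) p)"

lemma state_step: "state p (n + 1) = fwd (state p n)"
proof (cases "n \<ge> 1")
  case True
  then have "nat n = Suc (nat (n - 1))" by simp
  then show ?thesis using True by (simp add: state_def)
next
  case False
  then have "nat (1 - n) = Suc (nat (- n))" by simp
  then have "state p n = bwd ((bwd ^^ nat (- n)) p)" using False by (simp add: state_def)
  moreover have "state p (n + 1) = (bwd ^^ nat (- n)) p"
    using False by (auto simp: state_def)
  ultimately show ?thesis by (simp add: fwd_bwd)
qed

lemma state_fst:
  "state p n = (fst (state p n), fst (state p (n + 1)), fst (state p (n + 2)), fst (state p (n + 3)))"
  "fst (state p (n + 4)) =
     Max {fst (state p (n + 3)), fst (state p (n + 2)), fst (state p (n + 1)), 0} - fst (state p n)"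
proof -
  obtain a b c d where s: "state p n = (a, b, c, d)" by (cases "state p n")
  define e where "e = Max {d, c, b, 0} - a"
  define f where "f = Max {e, d, c, 0} - b"
  define g where "g = Max {f, e, d, 0} - c"
  define h where "h = Max {g, f, e, 0} - d"
  have 1: "state p (n + 1) = (b, c, d, e)"
    unfolding state_step s by (simp only: fwd.simps e_def)
  have 2: "state p (n + 2) = (c, d, e, f)"
    using state_step[of p "n + 1"] unfolding 1 fwd.simps f_def by (simp only: add.assoc one_add_one)
  have "state p (n + 3) = fwd (state p (n + 2))"
    using state_step[of p "n + 2"] by (simp only: add.assoc) simp
  then have 3: "state p (n + 3) = (d, e, f, g)"
    unfolding 2 fwd.simps g_def .
  have "state p (n + 4) = fwd (state p (n + 3))"
    using state_step[of p "n + 3"] by (simp only: add.assoc) simp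
  then have 4: "state p (n + 4) = (e, f, g, h)"
    unfolding 3 fwd.simps h_def .
  show "state p n = (fst (state p n), fst (state p (n + 1)), fst (state p (n + 2)), fst (state p (n + 3)))"
    unfolding s 1 2 3 by (simp only: fst_conv)
  show "fst (state p (n + 4)) =
     Max {fst (state p (n + 3)), fst (state p (n + 2)), fst (state p (n + 1)), 0} - fst (state p n)"
    unfolding s 1 2 3 4 by (simp only: fst_conv e_def)
qed

lemma two_sided_solution_unique:
  assumes s: "two_sided_solution s" and t: "two_sided_solution t"
    and init: "initial_tuple s = initial_tuple t"
  shows "s = t"
proof
  fix n :: int
  define P where "P m \<longleftrightarrow> s m = t m \<and> s (m + 1) = t (m + 1) \<and> s (m + 2) = t (m + 2)
    \<and> s (m + 3) = t (m + 3)" for m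
  have rs: "s (m + 4) = Max {s (m + 3), s (m + 2), s (m + 1), 0} - s m" for m
    using s unfolding two_sided_solution_def by blast
  have rt: "t (m + 4) = Max {t (m + 3), t (m + 2), t (m + 1), 0} - t m" for m
    using t unfolding two_sided_solution_def by blast
  have base: "P 1" using init by (simp add: P_def initial_tuple_def)
  have up: "P (m + 1)" if "P m" for m
    using that rs[of m] rt[of m] by (simp add: P_def add.assoc)
  have down: "P (m - 1)" if "P m" for m
  proof -
    have e: "m - 1 + 1 = m" "m - 1 + 2 = m + 1" "m - 1 + 3 = m + 2" "m - 1 + 4 = m + 3"
      by simp_all
    have c: "s m = t m" "s (m + 1) = t (m + 1)" "s (m + 2) = t (m + 2)" "s (m + 3) = t (m + 3)"
      using that by (simp_all only: P_def)
    have "s (m - 1) = t (m - 1)"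
      using rs[of "m - 1", unfolded e c] rt[of "m - 1", unfolded e] by linarith
    with c show ?thesis unfolding P_def e by blast
  qed
  have "P n"
    by (induction n rule: int_induct[of _ 1]) (use base up down in auto)
  then show "s n = t n" by (simp add: P_def)
qed

lemma ex1_two_sided_solution: "\<exists>!s. two_sided_solution s \<and> initial_tuple s = p"
proof -
  let ?s = "\<lambda>n. fst (state p n)"
  have "two_sided_solution ?s"
    unfolding two_sided_solution_def using state_fst(2) by blast
  moreover have "initial_tuple ?s = p"
  proof -
    have "state p 1 = p" by (simp add: state_def)
    moreover have "state p 1 = initial_tuple ?s"
      unfolding initial_tuple_def by (rule trans[OF state_fst(1)]) simp
    ultimately show ?thesis by metis
  qed
  ultimately show ?thesis using two_sided_solution_unique by (intro ex1I[of _ ?s]) auto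
qed

end

(* Every orbit reaches, after at most ten steps, a window (x, b, c, d) with x >= b, c, d >= 0.
   If b >= c >= d, the window recurs after 11 steps. Otherwise the orbit enters a family of windows
   T u = (x, u, z, w) and C u = (x, z, w, u) with x, z, w fixed, and from then on the parameter u
   moves by the rotation u -> u - (w - z) mod x of [0, x): 10 or 11 steps of the recurrence
   give one step of the rotation, and 22 steps lead from T u to C u if z <= u <= w. A rational
   (w - z) / x therefore forces periodicity. For an irrational one, Kronecker's theorem makes the
   parameters dense, and the entries u, u - x (for u >= w) and u - w (for w - z <= u <= w) of the
   orbit fill out the interval. The entries before the family is entered are also at most x: they are
   continuous functions of a later window T y, which the orbit approximates again and again. *)

theory Submission
  imports Defs
begin

section \<open>Invertibility of the recurrence\<close>

lemma bwd_fwd: "bwd (fwd p) = p"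
  by (cases p) (simp add: insert_commute)

lemma funpow_bwd_fwd: "(bwd ^^ n) ((fwd ^^ n) p) = p"
proof (induction n)
  case (Suc n)
  have "(bwd ^^ Suc n) ((fwd ^^ Suc n) p) = (bwd ^^ n) (bwd (fwd ((fwd ^^ n) p)))"
    unfolding funpow_Suc_right[of n bwd] by simp
  then show ?case using Suc by (simp add: bwd_fwd)
qed simp

lemma inj_funpow_fwd: "(fwd ^^ n) p = (fwd ^^ n) q \<Longrightarrow> p = q"
  by (metis funpow_bwd_fwd)

text \<open>Makes each entry of an orbit a continuous function of any later window, as
  \<open>le_x_of_recurrence\<close> requires.\<close>

lemma continuous_on_funpow_bwd: "continuous_on UNIV (bwd ^^ n)"
proof (induction n)
  case 0
  then show ?case by (simp add: id_def continuous_on_id)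
next
  case (Suc n)
  have bwd: "bwd = (\<lambda>p. (max (fst p) (max (fst (snd p)) (max (fst (snd (snd p))) 0)) - snd (snd (snd p)),
      fst p, fst (snd p), fst (snd (snd p))))"
    by (rule ext) (auto split: prod.splits)
  have "continuous_on UNIV bwd"
    unfolding bwd by (intro continuous_intros)
  then show ?case
    using Suc unfolding funpow.simps by (intro continuous_on_compose) (auto intro: continuous_on_subset)
qed

section \<open>Finite orbit segments and their certificates\<close>

text \<open>The closure is not reflexive: at least one step is taken, so
  \<open>leads UNIV p p\<close> yields a genuine period. The set \<open>I\<close> constrains the
  first entries of the windows before the last one.\<close>

definition leads :: "real set \<Rightarrow> tuple4 \<Rightarrow> tuple4 \<Rightarrow> bool" where
  "leads I = (\<lambda>p q. fst p \<in> I \<and> q = fwd p)\<^sup>+\<^sup>+"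

lemma leads_trans: "leads I p q \<Longrightarrow> leads I q r \<Longrightarrow> leads I p r"
  by (auto simp: leads_def)

lemma leads_fwd: "fst p \<in> I \<Longrightarrow> leads I p (fwd p)"
  by (auto simp: leads_def)

lemma leads_mono: "leads I p q \<Longrightarrow> I \<subseteq> J \<Longrightarrow> leads J p q"
  unfolding leads_def
proof (induction rule: tranclp_induct)
  case (base q)
  then show ?case by auto
next
  case (step q r)
  then show ?case by (auto intro: tranclp.trancl_into_trancl)
qed

lemma leads_funpow:
  assumes "leads I p q"
  obtains n where "n \<ge> 1" "(fwd ^^ n) p = q" "\<And>k. k < n \<Longrightarrow> fst ((fwd ^^ k) p) \<in> I"
proof -
  have "\<exists>n\<ge>1. (fwd ^^ n) p = q \<and> (\<forall>k<n. fst ((fwd ^^ k) p) \<in> I)"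
    using assms unfolding leads_def
  proof (induction rule: tranclp_induct)
    case (base q)
    then show ?case by (intro exI[of _ 1]) simp
  next
    case (step q r)
    then obtain n where "n \<ge> 1" "(fwd ^^ n) p = q" "\<forall>k<n. fst ((fwd ^^ k) p) \<in> I" by blast
    then show ?case using step.hyps by (intro exI[of _ "Suc n"]) (auto simp: less_Suc_eq)
  qed
  then show thesis using that by blast
qed

text \<open>A certificate for an orbit segment: the list holds consecutive entries, the last four
  being the target window. Checking it amounts to one membership and one equation per step.\<close>

fun trace :: "real set \<Rightarrow> real list \<Rightarrow> tuple4 \<Rightarrow> bool" where
  "trace I [a, b, c, d] q \<longleftrightarrow> q = (a, b, c, d)"
| "trace I (a # b # c # d # e # vs) q \<longleftrightarrow>
     a \<in> I \<and> e = Max {d, c, b, 0} - a \<and> trace I (b # c # d # e # vs) q"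
| "trace I _ q \<longleftrightarrow> False"

lemma trace_imp_leads:
  "trace I (a # b # c # d # e # vs) q \<Longrightarrow> leads I (a, b, c, d) q"
proof (induction vs arbitrary: a b c d e)
  case Nil
  then show ?case using leads_fwd[of "(a, b, c, d)" I] by simp
next
  case (Cons f vs)
  have "leads I (a, b, c, d) (b, c, d, e)"
    using Cons.prems leads_fwd[of "(a, b, c, d)" I] by simp
  moreover have "leads I (b, c, d, e) q"
    using Cons.prems by (intro Cons.IH[where e = f]) (simp only: trace.simps, blast)
  ultimately show ?case by (rule leads_trans)
qed

section \<open>Windows headed by their maximum\<close>

definition dominant :: "tuple4 \<Rightarrow> bool" where
  "dominant = (\<lambda>(a, b, c, d). 0 \<le> b \<and> 0 \<le> c \<and> 0 \<le> d \<and> b \<le> a \<and> c \<le> a \<and> d \<le> a)"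

text \<open>A finite case check: the letters \<open>e\<close> to \<open>n\<close> are the next ten
  entries, and piecewise linear arithmetic shows that one of the eleven windows is dominant.\<close>

lemma eventually_dominant: "\<exists>n. dominant ((fwd ^^ n) p)"
proof -
  obtain a b c d where p: "p = (a, b, c, d)" by (cases p)
  obtain e f g h i j k l m n where def:
    "e = max d (max c (max b 0)) - a" "f = max e (max d (max c 0)) - b"
    "g = max f (max e (max d 0)) - c" "h = max g (max f (max e 0)) - d"
    "i = max h (max g (max f 0)) - e" "j = max i (max h (max g 0)) - f"
    "k = max j (max i (max h 0)) - g" "l = max k (max j (max i 0)) - h"
    "m = max l (max k (max j 0)) - i" "n = max m (max l (max k 0)) - j"
    by blast
  have *: "dominant (a, b, c, d) \<or> dominant (b, c, d, e) \<or> dominant (c, d, e, f) \<or>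
      dominant (d, e, f, g) \<or> dominant (e, f, g, h) \<or> dominant (f, g, h, i) \<or>
      dominant (g, h, i, j) \<or> dominant (h, i, j, k) \<or> dominant (i, j, k, l) \<or>
      dominant (j, k, l, m) \<or> dominant (k, l, m, n)"
    using def unfolding dominant_def prod.case by (smt (verit))
  have F: "fwd (a, b, c, d) = (b, c, d, e)"
    "fwd (b, c, d, e) = (c, d, e, f)"
    "fwd (c, d, e, f) = (d, e, f, g)"
    "fwd (d, e, f, g) = (e, f, g, h)"
    "fwd (e, f, g, h) = (f, g, h, i)"
    "fwd (f, g, h, i) = (g, h, i, j)"
    "fwd (g, h, i, j) = (h, i, j, k)"
    "fwd (h, i, j, k) = (i, j, k, l)"
    "fwd (i, j, k, l) = (j, k, l, m)"
    "fwd (j, k, l, m) = (k, l, m, n)"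
    by (simp add: def(1), simp add: def(2), simp add: def(3), simp add: def(4), simp add: def(5), simp add: def(6), simp add: def(7), simp add: def(8), simp add: def(9), simp add: def(10))
  define R where "R q \<longleftrightarrow> (\<exists>n. q = (fwd ^^ n) p)" for q
  have R: "R (fwd q)" if "R q" for q
    using that unfolding R_def by (metis funpow.simps(2) comp_apply)
  have R0: "R (a, b, c, d)" unfolding R_def p by (rule exI[of _ 0]) simp
  note R1 = R[OF R0, unfolded F] note R2 = R[OF R1, unfolded F] note R3 = R[OF R2, unfolded F]
  note R4 = R[OF R3, unfolded F] note R5 = R[OF R4, unfolded F] note R6 = R[OF R5, unfolded F]
  note R7 = R[OF R6, unfolded F] note R8 = R[OF R7, unfolded F] note R9 = R[OF R8, unfolded F]
  note R10 = R[OF R9, unfolded F]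
  have "\<exists>q. R q \<and> dominant q"
    using * R0 R1 R2 R3 R4 R5 R6 R7 R8 R9 R10 by blast
  then show ?thesis by (auto simp: R_def)
qed

text \<open>The word in each application of \<open>trace_imp_leads\<close> is the
  orbit computed by hand; the hypotheses determine which term of every maximum is the largest.\<close>

lemma leads_cycle:
  fixes x y z w :: real
  assumes "0 \<le> w" "w \<le> z" "z \<le> y" "y \<le> x"
  shows "leads UNIV (x, y, z, w) (x, y, z, w)"
  by (rule trace_imp_leads[where e = "y - x" and
        vs = "[z - y, w - z, - w, x - y, x - z, x - w, x, y, z, w]"])
    (use assms in \<open>auto simp: max_def\<close>)

lemma leads_swap:
  fixes x y z w :: real
  assumes "0 \<le> y" "y \<le> z" "z \<le> w" "w \<le> x"
  shows "leads {min (w - x) (- y)..x} (x, y, z, w) (x, y, w, y + w - z)"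
  by (rule trace_imp_leads[where e = "w - x" and
        vs = "[w - y, w - z, - y, x - y, x - w, x - y - w + z, x, y, w, y + w - z]"])
    (use assms in \<open>auto simp: max_def\<close>)

section \<open>The induced rotation of the parameter\<close>

locale rotation =
  fixes x z w :: real
  assumes z_nonneg: "0 \<le> z" and z_less_w: "z < w" and w_le_x: "w \<le> x"
begin

definition I :: "real set" where "I = {min (w - x) (- z)..x}"

definition T :: "real \<Rightarrow> tuple4" where "T u = (x, u, z, w)"

definition C :: "real \<Rightarrow> tuple4" where "C u = (x, z, w, u)"

text \<open>The lemmas below treat \<open>T u\<close> for \<open>u \<ge> z\<close> and
  \<open>C u\<close> for \<open>u \<le> w\<close>. Where both apply, \<open>T u\<close> leads to
  \<open>C u\<close>, and \<open>S u\<close> picks the later window.\<close>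

definition S :: "real \<Rightarrow> tuple4" where "S u = (if u \<le> w then C u else T u)"

definition rot :: "real \<Rightarrow> real" where
  "rot u = (if w - z \<le> u then u - (w - z) else u + x - (w - z))"

lemma leads_T_T:
  assumes "w \<le> u" "u \<le> x"
  shows "leads I (T u) (T (u - (w - z)))"
  unfolding T_def I_def
  by (rule trace_imp_leads[where e = "u - x" and
        vs = "[w - u, w - z, - z, x - u + w - z, x - z, x - w, x, u - (w - z), z, w]"])
    (use assms z_nonneg z_less_w w_le_x in \<open>auto simp: max_def\<close>)

text \<open>Two rounds of 11 steps: the first replaces the parameter by its reflection
  \<open>z + w - u\<close>, the second is \<open>leads_swap\<close>, which reflects it back and
  moves it to the last place.\<close>

lemma leads_T_C:
  assumes "z \<le> u" "u \<le> w"
  shows "leads I (T u) (C u)"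
proof -
  have "leads I (T u) (x, z, z + w - u, w)"
    unfolding T_def I_def
    by (rule trace_imp_leads[where e = "w - x" and
          vs = "[w - u, w - z, - z, x - z, x - z - w + u, x - w, x, z, z + w - u, w]"])
      (use assms z_nonneg w_le_x in \<open>auto simp: max_def\<close>)
  moreover have "leads I (x, z, z + w - u, w) (C u)"
    using leads_swap[of z "z + w - u" w x] assms z_nonneg w_le_x by (simp add: C_def I_def)
  ultimately show ?thesis by (rule leads_trans)
qed

lemma leads_C_C:
  assumes "w - z \<le> u" "u \<le> w"
  shows "leads I (C u) (C (u - (w - z)))"
  unfolding C_def I_def
  by (rule trace_imp_leads[where e = "w - x" and
        vs = "[w - z, u - w, w - z - u, x - z, x - w, x - z - u + w, x, z, w, u - (w - z)]"])
    (use assms z_nonneg z_less_w w_le_x in \<open>auto simp: max_def\<close>)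

lemma leads_C_T:
  assumes "0 \<le> u" "u \<le> w - z"
  shows "leads I (C u) (T (u + x - (w - z)))"
  unfolding C_def T_def I_def
  by (rule trace_imp_leads[where e = "w - x" and
        vs = "[w - z, - z, w - z - u, x - z, x - w, x, u + x - (w - z), z, w]"])
    (use assms z_nonneg z_less_w w_le_x in \<open>auto simp: max_def\<close>)

lemma leads_T_S: "z \<le> u \<Longrightarrow> u \<le> w \<Longrightarrow> leads I (T u) (S u)"
  using leads_T_C by (simp add: S_def)

lemma rot_range: "u \<in> {0..<x} \<Longrightarrow> rot u \<in> {0..<x}"
  using z_nonneg z_less_w w_le_x by (auto simp: rot_def)

text \<open>The condition \<open>z < rot u\<close> leaves only \<open>u > w\<close>, where
  \<open>leads_T_T\<close> applies, and \<open>u < w - z\<close>, where \<open>leads_C_T\<close>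
  does. Strictness excludes \<open>u = w\<close>, since \<open>C w\<close> moves to
  \<open>C z\<close>.\<close>

lemma leads_S_T:
  assumes "u \<in> {0..<x}" "z < rot u"
  shows "leads I (S u) (T (rot u))"
  using assms leads_T_T[of u] leads_C_T[of u] z_nonneg z_less_w w_le_x
  by (auto simp: S_def rot_def split: if_splits)

lemma leads_S_S:
  assumes "u \<in> {0..<x}"
  shows "leads I (S u) (S (rot u))"
proof (cases "z < rot u")
  case True
  show ?thesis
  proof (cases "rot u \<le> w")
    case le: True
    show ?thesis
      by (rule leads_trans[OF leads_S_T[OF assms True] leads_T_S]) (use le True in auto)
  next
    case False
    then show ?thesis using leads_S_T[OF assms True] by (simp add: S_def)
  qed
next
  case False
  then have "u \<le> w" using z_nonneg z_less_w by (auto simp: rot_def split: if_splits)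
  show ?thesis
  proof (cases "w - z \<le> u")
    case True
    then show ?thesis
      using leads_C_C[OF True \<open>u \<le> w\<close>] \<open>u \<le> w\<close> z_less_w by (simp add: S_def rot_def)
  next
    case less: False
    have "leads I (S u) (T (rot u))"
      using leads_C_T[of u] less assms \<open>u \<le> w\<close> by (simp add: S_def rot_def)
    \<comment> \<open>Wrapping around gives \<open>rot u \<ge> z\<close> because
      \<open>w \<le> x\<close>, so only the boundary value is left in this case.\<close>
    moreover have "rot u = z"
      using False less assms w_le_x by (auto simp: rot_def)
    ultimately show ?thesis
      using leads_T_S[of z] z_less_w leads_trans by auto
  qed
qed

text \<open>The value \<open>u = x\<close>, possible only if \<open>w = x\<close>, lies outside the
  half-open interval; \<open>leads_C_C\<close> moves it inside.\<close>

lemma leads_C_start: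
  assumes "0 \<le> u" "u \<le> w"
  shows "\<exists>v\<in>{0..<x}. leads I (C u) (S v)"
proof (cases "u < x")
  case True
  then show ?thesis using leads_S_S[of u] rot_range[of u] assms by (auto simp: S_def[of u])
next
  case False
  then have "u - (w - z) \<in> {0..<x}" "leads I (C u) (S (u - (w - z)))"
    using leads_C_C[of u] assms z_nonneg z_less_w w_le_x by (auto simp: S_def)
  then show ?thesis by blast
qed

lemma leads_T_start:
  assumes "z \<le> u" "u \<le> x"
  shows "\<exists>v\<in>{0..<x}. leads I (T u) (S v)"
proof (cases "u \<le> w")
  case True
  then show ?thesis
    using leads_T_C[of u] leads_C_start[of u] assms z_nonneg leads_trans by fastforce
next
  case False
  let ?v = "u - (w - z)"
  have v: "?v \<in> {0..<x}" "z \<le> ?v" using False assms z_nonneg z_less_w by auto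
  have "leads I (T u) (T ?v)" using leads_T_T False assms by simp
  moreover have "S ?v = T ?v \<or> leads I (T ?v) (S ?v)"
    using leads_T_S[of ?v] v by (auto simp: S_def)
  ultimately show ?thesis using v(1) leads_trans by metis
qed

lemma funpow_rot:
  assumes "u \<in> {0..<x}"
  shows "(rot ^^ n) u \<in> {0..<x}" "\<exists>m::int. (rot ^^ n) u = u - real n * (w - z) + m * x"
proof -
  show r: "(rot ^^ n) u \<in> {0..<x}" for n
    by (induction n) (use assms rot_range in auto)
  show "\<exists>m::int. (rot ^^ n) u = u - real n * (w - z) + m * x"
  proof (induction n)
    case 0
    then show ?case by (intro exI[of _ 0]) simp
  next
    case (Suc n)
    then obtain m :: int where m: "(rot ^^ n) u = u - real n * (w - z) + m * x" by blast
    have "rot v = v - (w - z) \<or> rot v = v - (w - z) + x" for v by (auto simp: rot_def)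
    then consider "(rot ^^ Suc n) u = (rot ^^ n) u - (w - z)"
      | "(rot ^^ Suc n) u = (rot ^^ n) u - (w - z) + x"
      by (metis funpow.simps(2) comp_apply)
    then show ?case
    proof cases
      case 1
      then show ?thesis by (intro exI[of _ m]) (simp add: m algebra_simps)
    next
      case 2
      then show ?thesis by (intro exI[of _ "m + 1"]) (simp add: m algebra_simps)
    qed
  qed
qed

text \<open>Residues modulo \<open>x\<close> have unique representatives in \<open>{0..<x}\<close>;
  this turns congruences for iterates of \<open>rot\<close> into equations.\<close>

lemma int_multiple_eqI:
  assumes "a = b + real_of_int m * x" "a \<in> {0..<x}" "b \<in> {0..<x}"
  shows "a = b"
proof -
  have "\<bar>real_of_int m * x\<bar> < 1 * x" using assms by auto
  moreover have "\<bar>real_of_int m * x\<bar> = \<bar>real_of_int m\<bar> * x"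
    using assms by (auto simp: abs_mult)
  ultimately have "\<bar>real_of_int m\<bar> < 1"
    using assms(2) by (simp add: mult_less_cancel_right)
  then have "m = 0" by linarith
  then show ?thesis using assms by simp
qed

lemma rot_periodic:
  assumes "u \<in> {0..<x}" "(w - z) / x \<in> \<rat>"
  shows "\<exists>n\<ge>1. (rot ^^ n) u = u"
proof -
  have x: "x > 0" using assms by auto
  obtain a :: int and n :: nat where n: "n \<noteq> 0" "(w - z) / x = of_int a / of_nat n"
    using assms(2) unfolding Rats_eq_int_div_nat by auto
  then have "real n * (w - z) = a * x" using x by (simp add: field_simps)
  moreover obtain m :: int where "(rot ^^ n) u = u - real n * (w - z) + m * x"
    using funpow_rot(2)[OF assms(1)] by blast
  ultimately have "(rot ^^ n) u = u + real_of_int (m - a) * x"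
    by (simp add: algebra_simps)
  then have "(rot ^^ n) u = u"
    using int_multiple_eqI funpow_rot(1) assms(1) by blast
  then show ?thesis using n(1) by (intro exI[of _ n]) simp
qed

lemma rot_dense:
  assumes u: "u \<in> {0..<x}" and irr: "(w - z) / x \<notin> \<rat>" and I: "0 \<le> \<alpha>" "\<alpha> < \<beta>" "\<beta> \<le> x"
  shows "\<exists>n\<ge>N. (rot ^^ n) u \<in> {\<alpha><..<\<beta>}"
proof -
  \<comment> \<open>Starting from the \<open>N\<close>-th iterate makes the final index at least
    \<open>N\<close>; the midpoint \<open>c\<close> is the target.\<close>
  define v c where "v = (rot ^^ N) u" and "c = (\<alpha> + \<beta>) / 2"
  have v: "v \<in> {0..<x}" using funpow_rot(1)[OF u] by (simp add: v_def)
  have x: "x > 0" using I by simp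
  then have "(\<beta> - \<alpha>) / (2 * x) > 0" using I by simp
  \<comment> \<open>Modulo 1, \<open>k * ((w - z) / x)\<close> approximates
    \<open>(v - c) / x\<close>, so \<open>k\<close> further rotations carry \<open>v\<close> close
    to \<open>c\<close>.\<close>
  then obtain h k :: int where k: "k > 0"
    and hk: "\<bar>k * ((w - z) / x) - h - (v - c) / x\<bar> < (\<beta> - \<alpha>) / (2 * x)"
    using sequence_of_fractional_parts_is_dense[OF irr] by metis
  have "k * ((w - z) / x) - h - (v - c) / x = (k * (w - z) - h * x - (v - c)) / x"
    using x by (simp add: field_simps)
  with hk have "\<bar>k * (w - z) - h * x - (v - c)\<bar> / x < (\<beta> - \<alpha>) / 2 / x"
    using x by (simp add: abs_divide)
  then have "\<bar>k * (w - z) - h * x - (v - c)\<bar> < (\<beta> - \<alpha>) / 2"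
    using x by (metis divide_less_cancel order_less_not_sym)
  then have b: "v - k * (w - z) + h * x \<in> {\<alpha><..<\<beta>}"
    by (auto simp: c_def abs_less_iff field_simps)
  obtain m :: int where "(rot ^^ nat k) v = v - real (nat k) * (w - z) + m * x"
    using funpow_rot(2)[OF v] by blast
  then have "(rot ^^ nat k) v = (v - k * (w - z) + h * x) + real_of_int (m - h) * x"
    using k by (simp add: algebra_simps)
  then have "(rot ^^ nat k) v = v - k * (w - z) + h * x"
    using int_multiple_eqI funpow_rot(1)[OF v] b I by fastforce
  with b have "(rot ^^ (nat k + N)) u \<in> {\<alpha><..<\<beta>}"
    by (simp add: v_def funpow_add)
  then show ?thesis using le_add2 by blast
qed

text \<open>Each rotation costs at least one step of the recurrence, hence \<open>t \<ge> n\<close>.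
  This yields arbitrarily late visits and, for \<open>n\<close> beyond a given position, the bound
  on the entry there.\<close>

lemma visit_S:
  assumes "u \<in> {0..<x}"
  shows "\<exists>t\<ge>n. (fwd ^^ t) (S u) = S ((rot ^^ n) u) \<and> (\<forall>k<t. fst ((fwd ^^ k) (S u)) \<in> I)"
proof (induction n)
  case 0
  then show ?case by (intro exI[of _ 0]) simp
next
  case (Suc n)
  then obtain t where t: "t \<ge> n" "(fwd ^^ t) (S u) = S ((rot ^^ n) u)"
    "\<forall>k<t. fst ((fwd ^^ k) (S u)) \<in> I" by blast
  obtain s where s: "s \<ge> 1" "(fwd ^^ s) (S ((rot ^^ n) u)) = S ((rot ^^ Suc n) u)"
    "\<And>k. k < s \<Longrightarrow> fst ((fwd ^^ k) (S ((rot ^^ n) u))) \<in> I"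
    using leads_funpow[OF leads_S_S[OF funpow_rot(1)[OF assms]]] by auto
  have "fst ((fwd ^^ k) (S u)) \<in> I" if "k < s + t" for k
  proof (cases "k < t")
    case False
    then have "(fwd ^^ k) (S u) = (fwd ^^ (k - t)) ((fwd ^^ t) (S u))"
      using funpow_add[of "k - t" t fwd] by simp
    then show ?thesis using s(3)[of "k - t"] t(2) that False by simp
  qed (use t in blast)
  moreover have "(fwd ^^ (s + t)) (S u) = S ((rot ^^ Suc n) u)"
    using s(2) t(2) by (simp add: funpow_add)
  ultimately show ?case using s(1) t(1) by (intro exI[of _ "s + t"]) auto
qed

text \<open>The normal form is a window \<open>T y\<close> with \<open>z < y < w\<close>, where
  \<open>S y\<close> is \<open>C y\<close>; so the intermediate visits to \<open>T\<close> must be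
  tracked as well.\<close>

lemma visit_T:
  assumes "u \<in> {0..<x}" "z < (rot ^^ Suc n) u"
  shows "\<exists>t\<ge>n. (fwd ^^ t) (S u) = T ((rot ^^ Suc n) u)"
proof -
  obtain t where t: "t \<ge> n" "(fwd ^^ t) (S u) = S ((rot ^^ n) u)"
    using visit_S[OF assms(1)] by blast
  obtain s where s: "(fwd ^^ s) (S ((rot ^^ n) u)) = T ((rot ^^ Suc n) u)"
    using leads_funpow[OF leads_S_T[OF funpow_rot(1)[OF assms(1), of n]]] assms(2) by auto
  show ?thesis using s t by (intro exI[of _ "s + t"]) (simp add: funpow_add)
qed

lemma orbit_S_bounded: "u \<in> {0..<x} \<Longrightarrow> fst ((fwd ^^ k) (S u)) \<in> I"
  using visit_S[of u "Suc k"] by auto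

end

section \<open>Windows of a solution, equivalence, accumulation points\<close>

text \<open>The shift by one is due to indices starting at 1: \<open>window xs 0\<close> is the
  tuple of initial conditions.\<close>

definition window :: "(nat \<Rightarrow> real) \<Rightarrow> nat \<Rightarrow> tuple4" where
  "window xs n = (xs (n + 1), xs (n + 2), xs (n + 3), xs (n + 4))"

lemma fst_window [simp]: "fst (window xs n) = xs (Suc n)"
  by (simp add: window_def)

lemma fwd_window:
  assumes "one_sided_solution xs"
  shows "fwd (window xs n) = window xs (Suc n)"
proof -
  have "xs (Suc n + 4) = Max {xs (Suc n + 3), xs (Suc n + 2), xs (Suc n + 1), 0} - xs (Suc n)"
    using assms unfolding one_sided_solution_def by (metis le_add1 plus_1_eq_Suc)
  then show ?thesis by (simp add: window_def eval_nat_numeral)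
qed

lemma funpow_fwd_window:
  assumes "one_sided_solution xs"
  shows "(fwd ^^ k) (window xs n) = window xs (k + n)"
  by (induction k) (simp_all add: fwd_window[OF assms])

text \<open>Recurrence of a late window by itself gives only eventual periodicity; injectivity of
  \<open>fwd\<close> allows the first \<open>m\<close> steps to be undone.\<close>

lemma window_recurs_imp_periodic:
  assumes xs: "one_sided_solution xs" and "n \<ge> 1" "(fwd ^^ n) (window xs m) = window xs m"
  shows "periodic_seq xs"
proof -
  have "(fwd ^^ m) (window xs n) = (fwd ^^ m) (window xs 0)"
    using assms(3) by (simp add: funpow_fwd_window[OF xs] add.commute)
  then have "window xs n = window xs 0" by (rule inj_funpow_fwd)
  then have "window xs (k + n) = window xs k" for k
    using funpow_fwd_window[OF xs, of k n] funpow_fwd_window[OF xs, of k 0] by simp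
  then have "xs (Suc (k + n)) = xs (Suc k)" for k
    by (metis fst_window)
  then have "xs (k + n) = xs k" if "k \<ge> 1" for k
    using that by (cases k) auto
  with \<open>n \<ge> 1\<close> show ?thesis by (auto simp: periodic_seq_def)
qed

lemma two_sided_seq_spec:
  "two_sided_solution (two_sided_seq p)" "initial_tuple (two_sided_seq p) = p"
  using theI'[OF ex1_two_sided_solution[of p]] by (simp_all add: two_sided_seq_def)

lemma two_sided_seq_eqI: "two_sided_solution s \<Longrightarrow> initial_tuple s = p \<Longrightarrow> two_sided_seq p = s"
  using two_sided_seq_spec two_sided_solution_unique by metis

text \<open>By uniqueness of two-sided solutions, the later window generates the original sequence
  shifted by \<open>n\<close>.\<close>

lemma equivalent_funpow_fwd: "equivalent_tuples p ((fwd ^^ n) p)"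
proof -
  define s where "s = two_sided_seq p"
  have rec: "s (m + 4) = Max {s (m + 3), s (m + 2), s (m + 1), 0} - s m" for m
    using two_sided_seq_spec(1)[of p] unfolding s_def two_sided_solution_def by blast
  have window: "(fwd ^^ n) p = (s (1 + int n), s (2 + int n), s (3 + int n), s (4 + int n))"
  proof (induction n)
    case 0
    then show ?case using two_sided_seq_spec(2)[of p] by (simp add: s_def initial_tuple_def)
  next
    case (Suc n)
    then show ?case
      using rec[of "1 + int n"] by (simp add: algebra_simps)
  qed
  have "two_sided_seq ((fwd ^^ n) p) = (\<lambda>m. s (m + int n))"
  proof (rule two_sided_seq_eqI)
    show "two_sided_solution (\<lambda>m. s (m + int n))"
      unfolding two_sided_solution_def
    proof
      fix m
      show "s (m + 4 + int n) =
          Max {s (m + 3 + int n), s (m + 2 + int n), s (m + 1 + int n), 0} - s (m + int n)"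
        using rec[of "m + int n"] by (simp add: algebra_simps)
    qed
    show "initial_tuple (\<lambda>m. s (m + int n)) = (fwd ^^ n) p"
      by (simp add: window initial_tuple_def)
  qed
  then show ?thesis
    unfolding equivalent_tuples_def s_def by (intro exI[of _ "- int n"]) simp
qed

text \<open>Dependent choice builds the subsequence, with tolerance \<open>1 / (k + 1)\<close> at
  stage \<open>k\<close> and each index beyond the previous one.\<close>

lemma accumulation_pointsI:
  assumes "\<And>\<epsilon> N. \<epsilon> > 0 \<Longrightarrow> \<exists>n\<ge>N. \<bar>xs n - l\<bar> < \<epsilon>"
  shows "l \<in> accumulation_points xs"
proof -
  have "\<exists>r. \<forall>k. (r k \<ge> 1 \<and> \<bar>xs (r k) - l\<bar> < inverse (real (Suc k))) \<and> r k < r (Suc k)"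
  proof (rule dependent_nat_choice)
    show "\<exists>n\<ge>1. \<bar>xs n - l\<bar> < inverse (real (Suc 0))"
      using assms[of "inverse (real (Suc 0))" 1] by simp
    show "\<exists>n. (n \<ge> 1 \<and> \<bar>xs n - l\<bar> < inverse (real (Suc (Suc k)))) \<and> m < n" for m k :: nat
    proof -
      have "inverse (real (Suc (Suc k))) > 0" by simp
      from assms[OF this, of "Suc m"] obtain n
        where "Suc m \<le> n" "\<bar>xs n - l\<bar> < inverse (real (Suc (Suc k)))" by blast
      then show ?thesis by (intro exI[of _ n]) linarith
    qed
  qed
  then obtain r where r: "\<And>k. r k \<ge> 1" "\<And>k. \<bar>xs (r k) - l\<bar> < inverse (real (Suc k))"
    "\<And>k. r k < r (Suc k)" by blast
  have "(\<lambda>k. xs (r k) - l) \<longlonglongrightarrow> 0"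
    by (rule Lim_null_comparison[OF _ LIMSEQ_inverse_real_of_nat])
      (use r(2) in \<open>simp add: less_imp_le del: of_nat_Suc\<close>)
  then have "(\<lambda>k. xs (r k)) \<longlonglongrightarrow> l" by (simp add: LIM_zero_iff)
  moreover have "strict_mono r" using r(3) by (simp add: strict_mono_Suc_iff)
  ultimately show ?thesis using r(1) by (auto simp: accumulation_points_def)
qed

lemma accumulation_points_subset:
  assumes "closed A" "\<And>n. n \<ge> N \<Longrightarrow> xs n \<in> A"
  shows "accumulation_points xs \<subseteq> A"
proof
  fix l assume "l \<in> accumulation_points xs"
  then obtain r where r: "strict_mono r" "(\<lambda>k. xs (r k)) \<longlonglongrightarrow> l"
    by (auto simp: accumulation_points_def)
  have "\<forall>\<^sub>F k in sequentially. xs (r k) \<in> A"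
    by (rule eventually_sequentiallyI[of N])
      (meson assms(2) r(1) seq_suble order_trans)
  then show "l \<in> A"
    using Lim_in_closed_set[OF assms(1)] r(2) by (metis sequentially_bot)
qed

section \<open>The orbit in the irrational case\<close>

context rotation
begin

context
  fixes xs :: "nat \<Rightarrow> real" and t0 :: nat and u0 :: real
  assumes xs: "one_sided_solution xs" and u0: "u0 \<in> {0..<x}"
    and start: "window xs t0 = S u0" and irrational: "(w - z) / x \<notin> \<rat>"
begin

lemma bounded: "n > t0 \<Longrightarrow> xs n \<in> I"
  using orbit_S_bounded[OF u0, of "n - Suc t0"] funpow_fwd_window[OF xs, of "n - Suc t0" t0] start
  by simp

lemma frequently_S:
  assumes "0 \<le> \<alpha>" "\<alpha> < \<beta>" "\<beta> \<le> x"
  shows "\<exists>n\<ge>N. \<exists>u\<in>{\<alpha><..<\<beta>}. window xs n = S u"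
proof -
  obtain n where n: "n \<ge> N" "(rot ^^ n) u0 \<in> {\<alpha><..<\<beta>}"
    using rot_dense[OF u0 irrational assms] by blast
  obtain t where "t \<ge> n" "(fwd ^^ t) (S u0) = S ((rot ^^ n) u0)"
    using visit_S[OF u0] by blast
  then show ?thesis
    using n funpow_fwd_window[OF xs, of t t0] start
    by (intro exI[of _ "t + t0"] conjI bexI[of _ "(rot ^^ n) u0"]) auto
qed

lemma frequently_T:
  assumes "z \<le> \<alpha>" "\<alpha> < \<beta>" "\<beta> \<le> x"
  shows "\<exists>n\<ge>N. n > t0 \<and> (\<exists>u\<in>{\<alpha><..<\<beta>}. window xs n = T u)"
proof -
  obtain n where n: "n \<ge> N + 2" "(rot ^^ n) u0 \<in> {\<alpha><..<\<beta>}"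
    using rot_dense[OF u0 irrational, of \<alpha> \<beta>] assms z_nonneg by auto
  then have "(rot ^^ Suc (n - 1)) u0 \<in> {\<alpha><..<\<beta>}" by simp
  moreover from this obtain t where "t \<ge> n - 1" "(fwd ^^ t) (S u0) = T ((rot ^^ Suc (n - 1)) u0)"
    using visit_T[OF u0, of "n - 1"] assms by auto
  ultimately show ?thesis
    using n(1) funpow_fwd_window[OF xs, of t t0] start
    by (intro exI[of _ "t + t0"] conjI bexI[of _ "(rot ^^ Suc (n - 1)) u0"]) auto
qed

lemma accumulation_points_nonneg:
  assumes "0 \<le> l" "l \<le> x"
  shows "l \<in> accumulation_points xs"
proof (rule accumulation_pointsI)
  fix \<epsilon> :: real and N assume "\<epsilon> > 0"
  obtain n u where n: "n \<ge> N" "u \<in> {max 0 (l - \<epsilon>)<..<min x (l + \<epsilon>)}" "window xs n = S u"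
  proof -
    have "\<exists>n\<ge>N. \<exists>u\<in>{max 0 (l - \<epsilon>)<..<min x (l + \<epsilon>)}. window xs n = S u"
      by (rule frequently_S) (use assms \<open>\<epsilon> > 0\<close> z_nonneg z_less_w w_le_x in linarith)+
    then show thesis using that by blast
  qed
  \<comment> \<open>The parameter is the second entry of \<open>T u\<close> and the fourth of
    \<open>C u\<close>, and \<open>window xs n\<close> begins at index \<open>n + 1\<close>.\<close>
  then have "xs (n + 2) = u \<or> xs (n + 4) = u"
    by (auto simp: window_def S_def T_def C_def split: if_splits)
  moreover have "\<bar>u - l\<bar> < \<epsilon>" using n(2) by auto
  ultimately show "\<exists>n\<ge>N. \<bar>xs n - l\<bar> < \<epsilon>"
    using n(1) by (meson trans_le_add1)
qed

text \<open>For \<open>u\<close> just above \<open>l + x\<close> the window is \<open>T u\<close>,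
  and the entry right after it is \<open>u - x\<close>, close to \<open>l\<close>.\<close>

lemma accumulation_points_ge_w_minus_x:
  assumes "w - x \<le> l" "l < 0"
  shows "l \<in> accumulation_points xs"
proof (rule accumulation_pointsI)
  fix \<epsilon> :: real and N assume "\<epsilon> > 0"
  obtain n u where n: "n \<ge> N" "u \<in> {l + x<..<min x (l + x + \<epsilon>)}" "window xs n = S u"
  proof -
    have "\<exists>n\<ge>N. \<exists>u\<in>{l + x<..<min x (l + x + \<epsilon>)}. window xs n = S u"
      by (rule frequently_S) (use assms \<open>\<epsilon> > 0\<close> z_nonneg z_less_w in linarith)+
    then show thesis using that by blast
  qed
  then have "w < u" using assms by auto
  then have "window xs n = (x, u, z, w)" using n(3) by (simp add: S_def T_def)
  then have "window xs (Suc n) = (u, z, w, u - x)"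
    using \<open>w < u\<close> z_nonneg z_less_w unfolding fwd_window[OF xs, symmetric] by simp
  then have "xs (n + 5) = u - x" by (simp add: window_def eval_nat_numeral)
  moreover have "\<bar>u - x - l\<bar> < \<epsilon>" using n(2) by auto
  ultimately show "\<exists>n\<ge>N. \<bar>xs n - l\<bar> < \<epsilon>"
    using n(1) by (metis trans_le_add1)
qed

text \<open>For \<open>u\<close> just above \<open>l + w\<close> the window is \<open>C u\<close>,
  and the third entry after it is \<open>u - w\<close>, close to \<open>l\<close>.\<close>

lemma accumulation_points_ge_minus_z:
  assumes "- z \<le> l" "l < 0"
  shows "l \<in> accumulation_points xs"
proof (rule accumulation_pointsI)
  fix \<epsilon> :: real and N assume "\<epsilon> > 0"
  obtain n u where n: "n \<ge> N" "u \<in> {l + w<..<min w (l + w + \<epsilon>)}" "window xs n = S u"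
  proof -
    have "\<exists>n\<ge>N. \<exists>u\<in>{l + w<..<min w (l + w + \<epsilon>)}. window xs n = S u"
      by (rule frequently_S) (use assms \<open>\<epsilon> > 0\<close> z_less_w w_le_x in linarith)+
    then show thesis using that by blast
  qed
  then have u: "w - z < u" "u < w" using assms by auto
  then have "window xs n = (x, z, w, u)" using n(3) by (simp add: S_def C_def)
  then have "window xs (Suc n) = (z, w, u, w - x)"
    using u z_nonneg z_less_w unfolding fwd_window[OF xs, symmetric] by simp
  then have "window xs (Suc (Suc n)) = (w, u, w - x, w - z)"
    using u z_nonneg z_less_w w_le_x unfolding fwd_window[OF xs, symmetric] by (simp add: max_def)
  then have "window xs (Suc (Suc (Suc n))) = (u, w - x, w - z, u - w)"
    using u z_nonneg z_less_w w_le_x unfolding fwd_window[OF xs, symmetric] by (simp add: max_def)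
  then have "xs (n + 7) = u - w" by (simp add: window_def eval_nat_numeral)
  moreover have "\<bar>u - w - l\<bar> < \<epsilon>" using n(2) by auto
  ultimately show "\<exists>n\<ge>N. \<bar>xs n - l\<bar> < \<epsilon>"
    using n(1) by (metis trans_le_add1)
qed

lemma accumulation_points_eq: "accumulation_points xs = {min (w - x) (- z)..x}"
proof
  show "accumulation_points xs \<subseteq> {min (w - x) (- z)..x}"
    by (rule accumulation_points_subset[of _ "Suc t0"]) (use bounded in \<open>auto simp: I_def\<close>)
  show "{min (w - x) (- z)..x} \<subseteq> accumulation_points xs"
  proof
    fix l assume l: "l \<in> {min (w - x) (- z)..x}"
    then consider "0 \<le> l" | "w - x \<le> l" "l < 0" | "- z \<le> l" "l < 0"
      by (metis atLeastAtMost_iff min_le_iff_disj not_le)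
    then show "l \<in> accumulation_points xs"
    proof cases
      case 1
      then show ?thesis using accumulation_points_nonneg l by simp
    next
      case 2
      then show ?thesis by (rule accumulation_points_ge_w_minus_x)
    next
      case 3
      then show ?thesis by (rule accumulation_points_ge_minus_z)
    qed
  qed
qed

text \<open>Covers the entries up to \<open>t0\<close>, about which \<open>bounded\<close> says
  nothing. An entry above \<open>x\<close> that lies \<open>k\<close> steps before
  \<open>T y\<close> would force one \<open>k\<close> steps before each \<open>T v\<close> with
  \<open>v\<close> near \<open>y\<close>, hence also at late indices.\<close>

lemma le_x_of_recurrence:
  assumes m: "window xs m = T y" "z < y" "y < w" and n: "1 \<le> n" "n \<le> Suc m"
  shows "xs n \<le> x"
proof (rule ccontr)
  assume "\<not> xs n \<le> x"
  define k where "k = Suc m - n"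
  define g where "g v = fst ((bwd ^^ k) (T v))" for v
  have backwards: "fst ((bwd ^^ k) (window xs (j + k))) = xs (Suc j)" for j
    using funpow_fwd_window[OF xs, of k j] funpow_bwd_fwd[of k "window xs j"]
    by (simp add: add.commute)
  have "m = (n - 1) + k" using n by (simp add: k_def)
  then have "g y = xs n" using backwards[of "n - 1"] m(1) n(1) by (simp add: g_def)
  have "continuous_on UNIV g"
    unfolding g_def T_def
    by (intro continuous_intros continuous_on_compose2[OF continuous_on_funpow_bwd]) auto
  then have "open (g -` {x<..})" by (intro open_vimage) auto
  moreover have "y \<in> g -` {x<..}" using \<open>g y = xs n\<close> \<open>\<not> xs n \<le> x\<close> by simp
  ultimately obtain \<delta> where \<delta>: "\<delta> > 0" "\<And>v. \<bar>v - y\<bar> < \<delta> \<Longrightarrow> g v > x"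
    unfolding open_dist by (auto simp: dist_real_def)
  \<comment> \<open>The visit is so late that going back \<open>k\<close> steps still lands beyond
    \<open>t0\<close>.\<close>
  obtain j v where j: "j \<ge> Suc t0 + k" "v \<in> {y<..<min w (y + \<delta>)}" "window xs j = T v"
  proof -
    have "\<exists>j\<ge>Suc t0 + k. j > t0 \<and> (\<exists>v\<in>{y<..<min w (y + \<delta>)}. window xs j = T v)"
      by (rule frequently_T) (use m \<delta>(1) w_le_x in linarith)+
    then show thesis using that by blast
  qed
  have "xs (Suc (j - k)) = g v"
    using backwards[of "j - k"] j(1,3) by (simp add: g_def)
  moreover have "g v > x" using \<delta>(2)[of v] j(2) by auto
  moreover have "Suc (j - k) > t0" using j(1) by linarith
  ultimately show False using bounded[of "Suc (j - k)"] by (auto simp: I_def)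
qed

text \<open>Any visited \<open>T y\<close> with \<open>z < y < w\<close> serves as the tuple; its
  first entry shows that the bound \<open>x\<close> is attained.\<close>

lemma normal_form:
  "\<exists>x y z w. equivalent_tuples (window xs 0) (x, y, z, w) \<and> is_maximum_of x xs \<and>
     w \<le> x \<and> y \<le> w \<and> z \<le> y \<and> 0 \<le> z \<and> (w - z) / x \<notin> \<rat> \<and>
     accumulation_points xs = {min (w - x) (- z)..x}"
proof -
  obtain m y where m: "m > t0" "y \<in> {z<..<w}" "window xs m = T y"
    using frequently_T[of z w 0] z_less_w w_le_x by auto
  have "xs n \<le> x" if "n \<ge> 1" for n
    using le_x_of_recurrence[OF m(3), of n] bounded[of n] m that
    by (cases "n \<le> Suc m") (auto simp: I_def)
  moreover have "xs (Suc m) = x" using m(3) by (simp add: window_def T_def)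
  ultimately have "is_maximum_of x xs"
    unfolding is_maximum_of_def by (metis le_add1 plus_1_eq_Suc)
  moreover have "equivalent_tuples (window xs 0) (x, y, z, w)"
    using equivalent_funpow_fwd[of "window xs 0" m] funpow_fwd_window[OF xs, of m 0] m(3)
    by (simp add: T_def)
  ultimately show ?thesis
    using m(2) z_nonneg w_le_x irrational accumulation_points_eq
    by (intro exI[of _ x] exI[of _ y] exI[of _ z] exI[of _ w]) auto
qed

end

lemma S_periodic:
  assumes "u \<in> {0..<x}" "(w - z) / x \<in> \<rat>"
  shows "\<exists>n\<ge>1. (fwd ^^ n) (S u) = S u"
  using rot_periodic[OF assms] visit_S[OF assms(1)] by (metis order_trans)

end

section \<open>Case distinction and conclusion\<close>

text \<open>The order of the last three entries decides: nonincreasing gives the cycle,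
  \<open>c < d\<close> with \<open>c \<le> b\<close> gives \<open>T b\<close>, and
  \<open>b < c\<close> with \<open>d \<le> c\<close> gives \<open>C d\<close>. For the remaining
  increasing orders \<open>leads_swap\<close> produces a window \<open>C\<close>.\<close>

lemma dominant_cases:
  assumes "dominant p"
  obtains (periodic) "leads UNIV p p"
  | (rotation) x z w u where "rotation x z w" "u \<in> {0..<x}" "leads UNIV p (rotation.S x z w u)"
proof -
  obtain x b c d where p: "p = (x, b, c, d)" by (cases p)
  have pos: "0 \<le> b" "0 \<le> c" "0 \<le> d" "b \<le> x" "c \<le> x" "d \<le> x"
    using assms by (auto simp: dominant_def p)
  \<comment> \<open>Here \<open>q\<close> is \<open>p\<close> itself or the outcome of
    \<open>leads_swap\<close>, and the two alternatives for it are \<open>T u\<close> and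
    \<open>C u\<close>.\<close>
  have rot: thesis
    if "rotation x z w" and q: "q = p \<or> leads UNIV p q"
      and "z \<le> u \<and> u \<le> x \<and> q = (x, u, z, w) \<or> 0 \<le> u \<and> u \<le> w \<and> q = (x, z, w, u)" for q z w u
  proof -
    interpret rotation x z w by fact
    have "\<exists>v\<in>{0..<x}. leads I q (S v)"
      using that(3) leads_T_start leads_C_start by (auto simp: T_def C_def)
    then obtain v where v: "v \<in> {0..<x}" "leads I q (S v)" by blast
    then have "leads UNIV q (S v)" using leads_mono by blast
    then have "leads UNIV p (S v)" using q leads_trans by blast
    then show thesis using rotation[OF rotation_axioms v(1)] by blast
  qed
  consider "d \<le> c" "c \<le> b" | "c < d" "c \<le> b" | "b < c" "d \<le> c" | "b < c" "c < d" | "b < d" "b \<le> c" "c \<le> d"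
    by linarith
  then show thesis
  proof cases
    case 1
    then show thesis using periodic leads_cycle[of d c b x] pos by (simp add: p)
  next
    case 2
    then show thesis using rot[of c d p b] pos by (simp add: p rotation_def)
  next
    case 3
    then show thesis using rot[of b c p d] pos by (simp add: p rotation_def)
  next
    case 4
    then have "leads UNIV p (x, b, d, b + d - c)"
      using leads_mono[OF leads_swap[of b c d x]] pos by (simp add: p)
    then show thesis using rot[of b d "(x, b, d, b + d - c)" "b + d - c"] pos 4
      by (simp add: rotation_def)
  next
    case 5
    then have "leads UNIV p (x, b, d, b + d - c)"
      using leads_mono[OF leads_swap[of b c d x]] pos by (simp add: p)
    then show thesis using rot[of b d "(x, b, d, b + d - c)" "b + d - c"] pos 5
      by (simp add: rotation_def)
  qed
qed

theorem theorem1: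
  fixes xs :: "nat \<Rightarrow> real"
  assumes "one_sided_solution xs"
    and "\<not> periodic_seq xs"
  shows "(\<exists>a b. a \<le> b \<and> accumulation_points xs = {a..b}) \<and>
    (\<exists>x y z w :: real.
       equivalent_tuples (xs 1, xs 2, xs 3, xs 4) (x, y, z, w) \<and>
       is_maximum_of x xs \<and>
       x \<ge> w \<and> w \<ge> y \<and> y \<ge> z \<and> z \<ge> 0 \<and>
       (w - z) / x \<notin> \<rat> \<and>
       accumulation_points xs = {min (w - x) (- z)..x})"
proof -
  note xs = assms(1)
  have no_recurrence: "(fwd ^^ n) (window xs m) \<noteq> window xs m" if "n \<ge> 1" for n m
    using window_recurs_imp_periodic[OF xs that] assms(2) by blast
  obtain n where n: "dominant (window xs n)"
    using eventually_dominant[of "window xs 0"] funpow_fwd_window[OF xs, of _ 0] by auto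
  from n have "\<exists>x y z w. equivalent_tuples (window xs 0) (x, y, z, w) \<and> is_maximum_of x xs \<and>
     w \<le> x \<and> y \<le> w \<and> z \<le> y \<and> 0 \<le> z \<and> (w - z) / x \<notin> \<rat> \<and>
     accumulation_points xs = {min (w - x) (- z)..x}"
  proof (cases rule: dominant_cases)
    case periodic
    then show ?thesis using no_recurrence leads_funpow by metis
  next
    case (rotation x z w u)
    interpret rotation x z w by fact
    obtain k where "(fwd ^^ k) (window xs n) = S u"
      using leads_funpow[OF rotation(3)] by blast
    then have k: "window xs (k + n) = S u" by (simp add: funpow_fwd_window[OF xs])
    then have "(w - z) / x \<notin> \<rat>"
      using S_periodic[OF rotation(2)] no_recurrence[of _ "k + n"] by auto
    then show ?thesis using normal_form[OF xs rotation(2) k] by blast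
  qed
  then obtain x y z w where *: "equivalent_tuples (window xs 0) (x, y, z, w)" "is_maximum_of x xs"
     "w \<le> x" "y \<le> w" "z \<le> y" "0 \<le> z" "(w - z) / x \<notin> \<rat>"
     "accumulation_points xs = {min (w - x) (- z)..x}" by blast
  have "equivalent_tuples (xs 1, xs 2, xs 3, xs 4) (x, y, z, w)"
    using *(1) by (simp add: window_def eval_nat_numeral)
  moreover have "min (w - x) (- z) \<le> x" using * by linarith
  ultimately show ?thesis using * by blast
qed

end
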